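(* Let $\Omega=\{-1,0,1\}^{\mathbb N}$ with its Haar probability measure $\nu$, and for $\omega\in\Omega$ let $\Phi_\omega(t)=\sum_{n=1}^{\infty}\omega(n)e^{-nt}$, $t>0$. For every $0<p<2$, $$\nu\{\omega\in\Omega:\Phi_\omega\in L^p(0,\infty)\}=1.$$ Equivalently, for every $0<\varepsilon<2$, $$\nu\{\omega\in\Omega:\Phi_\omega\in L^{2-\varepsilon}(0,\infty)\}=1.$$
   Context: $\mathbb N=\{1,2,3,\dots\}$. The set $G=\{-1,0,1\}$ is identified with the additive group $\mathbb Z/3\mathbb Z$, and $\Omega=G^{\mathbb N}$ is the product compact group; its Haar probability measure $\nu$ is the product of the uniform measures on $\{-1,0,1\}$, so that the coordinates $\omega\mapsto\omega(n)$ are independent and uniformly distributed on $\{-1,0,1\}$. The series defining $\Phi_\omega(t)$ converges absolutely for every $t>0$. For $p>0$ (including $p<1$), $\Phi_\omega\in L^p(0,\infty)$ means $\int_0^\infty|\Phi_\omega(t)|^p\,dt<\infty$. *)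

theory Defs
  imports "HOL-Probability.Probability"
begin

(* The Haar probability measure on the compact group Omega = {-1,0,1}^N, N = {1,2,3,...}, with
   {-1,0,1} identified with Z/3Z: it is the countable product of the uniform measures, and its
   product sigma-algebra is the Borel sigma-algebra of Omega.  The points of its space are the
   functions nat => int with values in {-1,0,1} on {1..} and undefined at 0. *)
definition haar_Omega :: "(nat \<Rightarrow> int) measure" where
  "haar_Omega = (\<Pi>\<^sub>M n\<in>{1..}. uniform_count_measure {-1, 0, 1})"

(* suminf starts at 0, hence the shift by Suc. *)
definition Phi :: "(nat \<Rightarrow> int) \<Rightarrow> real \<Rightarrow> real" where
  "Phi \<omega> t = (\<Sum>n. real_of_int (\<omega> (Suc n)) * exp (- (real (Suc n) * t)))"

(* Membership of (the restriction to S of) f in L^p(S), for any real p > 0; the class is not a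
   normed space when p < 1.  For p > 0 the powr convention 0 powr p = 0 is the right one. *)
definition in_Lp :: "real \<Rightarrow> real set \<Rightarrow> (real \<Rightarrow> real) \<Rightarrow> bool" where
  "in_Lp p S f \<longleftrightarrow>
     set_borel_measurable lebesgue S f \<and>
     (\<integral>\<^sup>+ t\<in>S. ennreal (\<bar>f t\<bar> powr p) \<partial>lebesgue) < \<infinity>"

end

(* The coordinates are orthogonal with variance 2/3, so E (Phi_omega(t)^2) <= exp(-t)/t =: s(t).
   Since |x|^p <= s^(p/2-1) x^2 + s^(p/2) for 0 < p < 2, this gives E |Phi_omega(t)|^p <= 2 s(t)^(p/2),
   whose integral over t > 0 is a Gamma integral, finite exactly because p < 2.  By Tonelli the
   integral of |Phi_omega|^p has finite expectation, hence is almost surely finite. *)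
theory Submission
  imports Defs
begin

section \<open>Bounding p-th moments by second moments\<close>

lemma powr_le_interpolation:
  fixes x s p :: real
  assumes "s > 0" "0 < p" "p < 2"
  shows "\<bar>x\<bar> powr p \<le> s powr (p/2 - 1) * x\<^sup>2 + s powr (p/2)"
proof -
  have "(\<bar>x\<bar> powr 2) powr (p/2) = \<bar>x\<bar> powr p"
    by (subst powr_powr) simp
  then have eq: "\<bar>x\<bar> powr p = (x\<^sup>2) powr (p/2)"
    by simp
  show ?thesis
  \<comment> \<open>If \<open>x\<^sup>2\<close> is at most \<open>s\<close>, the second summand
    alone dominates. Otherwise one factor \<open>x\<^sup>2\<close> is split off, and the remaining
    exponent \<open>p/2 - 1\<close> is negative, so replacing \<open>x\<^sup>2\<close> by the
    smaller \<open>s\<close> increases the power.\<close>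
  proof (cases "x\<^sup>2 \<le> s")
    case True
    have "(x\<^sup>2) powr (p/2) \<le> s powr (p/2)"
      using True assms by (intro powr_mono2) auto
    then show ?thesis by (simp add: eq add_increasing)
  next
    case False
    then have x: "x \<noteq> 0" using assms by auto
    have "\<bar>x\<bar> powr p = (x\<^sup>2) powr (p/2 - 1) * x\<^sup>2"
      using x by (simp add: eq powr_diff)
    also have "\<dots> \<le> s powr (p/2 - 1) * x\<^sup>2"
      using False assms by (intro mult_right_mono powr_mono2') auto
    finally show ?thesis by (simp add: add_increasing2)
  qed
qed

text \<open>A substitute for Jensen's inequality at the price of a factor 2: taking the
  interpolation threshold equal to the second-moment bound makes both summands contribute
  \<open>s powr (p/2)\<close>.\<close>

lemma (in prob_space) nn_integral_powr_le:
  fixes f :: "'a \<Rightarrow> real"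
  assumes [measurable]: "f \<in> borel_measurable M"
    and s: "s > 0" and p: "0 < p" "p < 2"
    and le: "(\<integral>\<^sup>+x. ennreal ((f x)\<^sup>2) \<partial>M) \<le> ennreal s"
  shows "(\<integral>\<^sup>+x. ennreal (\<bar>f x\<bar> powr p) \<partial>M) \<le> 2 * ennreal (s powr (p/2))"
proof -
  have "(\<integral>\<^sup>+x. ennreal (\<bar>f x\<bar> powr p) \<partial>M)
      \<le> (\<integral>\<^sup>+x. ennreal (s powr (p/2 - 1)) * ennreal ((f x)\<^sup>2) + ennreal (s powr (p/2)) \<partial>M)"
    using powr_le_interpolation[OF s p]
    by (intro nn_integral_mono) (simp flip: ennreal_mult ennreal_plus)
  also have "\<dots> = ennreal (s powr (p/2 - 1)) * (\<integral>\<^sup>+x. ennreal ((f x)\<^sup>2) \<partial>M) + ennreal (s powr (p/2))"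
    by (simp add: nn_integral_add nn_integral_cmult emeasure_space_1)
  also have "\<dots> \<le> ennreal (s powr (p/2 - 1)) * ennreal s + ennreal (s powr (p/2))"
    by (intro add_mono mult_left_mono le) auto
  also have "ennreal (s powr (p/2 - 1)) * ennreal s = ennreal (s powr (p/2))"
    using s by (simp flip: ennreal_mult add: powr_diff)
  also have "ennreal (s powr (p/2)) + ennreal (s powr (p/2)) = 2 * ennreal (s powr (p/2))"
    by (simp add: mult_2)
  finally show ?thesis .
qed

section \<open>Orthogonality of the coordinates\<close>

lemma product_prob_space_uniform: "product_prob_space (\<lambda>_. uniform_count_measure {-1, 0, 1 :: int})"
  by (intro product_prob_spaceI prob_space_uniform_count_measure) auto

lemma prob_space_haar_Omega: "prob_space haar_Omega"
  unfolding haar_Omega_def by (intro prob_space_PiM prob_space_uniform_count_measure) auto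

lemma abs_coordinate_le_1:
  assumes "\<omega> \<in> space haar_Omega" "n \<ge> 1"
  shows "\<bar>real_of_int (\<omega> n)\<bar> \<le> 1"
proof -
  have "\<omega> n \<in> {-1, 0, 1}"
    using assms by (auto simp: haar_Omega_def space_PiM space_uniform_count_measure PiE_def Pi_def)
  then show ?thesis by auto
qed

lemma measurable_uniform [measurable]:
  "real_of_int \<in> borel_measurable (uniform_count_measure {-1, 0, 1 :: int})"
  by (auto simp: measurable_def sets_uniform_count_measure space_uniform_count_measure)

lemma measurable_coordinate [measurable]:
  assumes "n \<ge> 1"
  shows "(\<lambda>\<omega>. real_of_int (\<omega> n)) \<in> borel_measurable haar_Omega"
  unfolding haar_Omega_def
  by (rule measurable_compose[OF _ measurable_uniform], rule measurable_component_singleton)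
    (use assms in auto)

text \<open>On the diagonal this is the variance (1 + 0 + 1)/3 of one coordinate; off the diagonal
  independence factors the integral into two means, both 0.\<close>

lemma integral_coordinate_prod:
  assumes "i \<ge> 1" "j \<ge> 1"
  shows "(\<integral>\<omega>. real_of_int (\<omega> i) * real_of_int (\<omega> j) \<partial>haar_Omega) = (if i = j then 2/3 else 0)"
proof -
  let ?U = "uniform_count_measure {-1, 0, 1 :: int}"
  interpret product_prob_space "\<lambda>_. ?U" "{1::nat..}"
    by (rule product_prob_space_uniform)
  have int: "integrable ?U f" for f :: "int \<Rightarrow> real"
    unfolding uniform_count_measure_def by (rule integrable_point_measure_finite) auto
  show ?thesis
  proof (cases "i = j")
    case True
    let ?g = "\<lambda>x::int. real_of_int x * real_of_int x"
    have "(\<integral>\<omega>. ?g (\<omega> i) \<partial>haar_Omega) = (\<integral>x. ?g x \<partial>distr haar_Omega ?U (\<lambda>\<omega>. \<omega> i))"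
      using assms unfolding haar_Omega_def by (subst integral_distr) auto
    also have "distr haar_Omega ?U (\<lambda>\<omega>. \<omega> i) = ?U"
      unfolding haar_Omega_def using assms by (intro PiM_component) auto
    also have "(\<integral>x. ?g x \<partial>?U) = 2/3"
      by (subst integral_uniform_count_measure) auto
    finally show ?thesis using True by simp
  next
    case False
    \<comment> \<open>The integrand depends only on the coordinates in \<open>?J\<close>. Pushing
      the measure forward to this finite product lets the integral split into a product of
      one-dimensional ones.\<close>
    let ?J = "{i, j}"
    let ?g = "\<lambda>\<omega>. \<Prod>n\<in>?J. real_of_int (\<omega> n)"
    have [measurable]: "?g \<in> borel_measurable (Pi\<^sub>M ?J (\<lambda>_. ?U))"
      by (intro borel_measurable_prod measurable_compose[OF _ measurable_uniform]
          measurable_component_singleton)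
    have "(\<integral>\<omega>. ?g \<omega> \<partial>haar_Omega) = (\<integral>\<omega>. ?g (restrict \<omega> ?J) \<partial>haar_Omega)"
      using False by simp
    also have "\<dots> = (\<integral>\<omega>. ?g \<omega> \<partial>distr haar_Omega (Pi\<^sub>M ?J (\<lambda>_. ?U)) (\<lambda>\<omega>. restrict \<omega> ?J))"
      unfolding haar_Omega_def using assms
      by (intro integral_distr[symmetric] measurable_restrict_subset) auto
    also have "distr haar_Omega (Pi\<^sub>M ?J (\<lambda>_. ?U)) (\<lambda>\<omega>. restrict \<omega> ?J) = Pi\<^sub>M ?J (\<lambda>_. ?U)"
      unfolding haar_Omega_def using assms by (intro distr_PiM_restrict_finite) auto
    also have "(\<integral>\<omega>. ?g \<omega> \<partial>Pi\<^sub>M ?J (\<lambda>_. ?U)) = (\<Prod>n\<in>?J. \<integral>x. real_of_int x \<partial>?U)"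
      by (intro product_integral_prod int) auto
    also have "(\<integral>x. real_of_int x \<partial>?U) = 0"
      by (subst integral_uniform_count_measure) auto
    finally show ?thesis using False by simp
  qed
qed

lemma integrable_coordinate_prod:
  assumes "i \<ge> 1" "j \<ge> 1"
  shows "integrable haar_Omega (\<lambda>\<omega>. real_of_int (\<omega> i) * real_of_int (\<omega> j))"
proof -
  interpret prob_space haar_Omega by (rule prob_space_haar_Omega)
  show ?thesis
  proof (rule integrable_const_bound[where B = 1])
    show "AE \<omega> in haar_Omega. norm (real_of_int (\<omega> i) * real_of_int (\<omega> j)) \<le> 1"
      using abs_coordinate_le_1 assms by (auto simp: abs_mult intro!: mult_le_one)
  qed (use assms in measurable)
qed

text \<open>Expanding the square gives a double sum in which orthogonality kills every term with
  distinct indices.\<close>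

lemma nn_integral_sum_coordinates_square:
  fixes c :: "nat \<Rightarrow> real"
  assumes J: "finite J" "J \<subseteq> {1..}"
  shows "(\<integral>\<^sup>+\<omega>. ennreal ((\<Sum>n\<in>J. c n * real_of_int (\<omega> n))\<^sup>2) \<partial>haar_Omega) = ennreal (2/3 * (\<Sum>n\<in>J. (c n)\<^sup>2))"
proof -
  have eq: "(\<Sum>n\<in>J. c n * real_of_int (\<omega> n))\<^sup>2
      = (\<Sum>i\<in>J. \<Sum>j\<in>J. c i * c j * (real_of_int (\<omega> i) * real_of_int (\<omega> j)))" for \<omega>
    by (simp add: power2_eq_square sum_product mult_ac)
  have int: "integrable haar_Omega (\<lambda>\<omega>. c i * c j * (real_of_int (\<omega> i) * real_of_int (\<omega> j)))"
    if "i \<in> J" "j \<in> J" for i j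
    using that J by (intro integrable_mult_right integrable_coordinate_prod) auto
  have "(\<integral>\<omega>. (\<Sum>n\<in>J. c n * real_of_int (\<omega> n))\<^sup>2 \<partial>haar_Omega)
      = (\<Sum>i\<in>J. \<Sum>j\<in>J. c i * c j * (\<integral>\<omega>. real_of_int (\<omega> i) * real_of_int (\<omega> j) \<partial>haar_Omega))"
    unfolding eq using int
    by (simp add: Bochner_Integration.integral_sum Bochner_Integration.integrable_sum)
  also have "\<dots> = (\<Sum>i\<in>J. \<Sum>j\<in>J. if i = j then 2/3 * (c i)\<^sup>2 else 0)"
    using J by (intro sum.cong refl, subst integral_coordinate_prod) (auto simp: power2_eq_square)
  also have "\<dots> = 2/3 * (\<Sum>n\<in>J. (c n)\<^sup>2)"
    using J by (simp add: sum_distrib_left)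
  finally have *: "(\<integral>\<omega>. (\<Sum>n\<in>J. c n * real_of_int (\<omega> n))\<^sup>2 \<partial>haar_Omega) = 2/3 * (\<Sum>n\<in>J. (c n)\<^sup>2)" .
  have "integrable haar_Omega (\<lambda>\<omega>. (\<Sum>n\<in>J. c n * real_of_int (\<omega> n))\<^sup>2)"
    unfolding eq using int by (intro Bochner_Integration.integrable_sum) auto
  then show ?thesis
    by (subst nn_integral_eq_integral) (auto simp: *)
qed

section \<open>Second moment of the random series\<close>

lemma measurable_Phi [measurable]:
  "(\<lambda>(\<omega>, t). Phi \<omega> t) \<in> borel_measurable (haar_Omega \<Otimes>\<^sub>M lborel)"
  unfolding Phi_def by measurable

text \<open>The coordinates are bounded by 1, so the geometric series with ratio
  \<open>exp (-t)\<close> < 1 dominates.\<close>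

lemma Phi_sums:
  assumes "\<omega> \<in> space haar_Omega" "t > 0"
  shows "(\<lambda>n. real_of_int (\<omega> (Suc n)) * exp (- (real (Suc n) * t))) sums Phi \<omega> t"
  unfolding Phi_def
proof (rule summable_sums, rule summable_comparison_test')
  show "summable (\<lambda>n. exp (-t) ^ Suc n)"
    using assms by (subst summable_Suc_iff, intro summable_geometric) auto
  show "norm (real_of_int (\<omega> (Suc n)) * exp (- (real (Suc n) * t))) \<le> exp (-t) ^ Suc n" for n
  proof -
    have "exp (- (real (Suc n) * t)) = exp (-t) ^ Suc n"
      by (subst exp_of_nat_mult[symmetric]) simp
    then show ?thesis
      using abs_coordinate_le_1[OF assms(1), of "Suc n"] by (simp add: abs_mult mult_left_le_one_le)
  qed
qed

text \<open>A geometric sum with ratio \<open>exp (-2*t)\<close>. The bound has to record both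
  regimes used later: the blow-up 1/t at 0 and exponential decay at infinity.\<close>

lemma sum_exp_le:
  assumes "t > (0::real)"
  shows "(\<Sum>n\<in>{1..N}. (exp (- (real n * t)))\<^sup>2) \<le> exp (-t) / t"
proof -
  define q where "q = exp (-2*t)"
  have q: "0 < q" "q < 1" using assms by (auto simp: q_def)
  have "(\<Sum>n\<in>{1..N}. (exp (- (real n * t)))\<^sup>2) = (\<Sum>n\<in>{1..N}. q ^ n)"
    by (intro sum.cong refl) (simp add: q_def flip: exp_of_nat_mult exp_double)
  also have "\<dots> \<le> q / (1 - q)"
  proof -
    have "(1 - q) * (\<Sum>n\<in>{1..N}. q ^ n) = q - q ^ Suc N"
      by (induction N) (simp_all add: distrib_left, simp add: algebra_simps)
    also have "\<dots> \<le> q" using q by simp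
    finally show ?thesis using q by (simp add: field_simps)
  qed
  \<comment> \<open>After clearing denominators and cancelling \<open>exp (-t)\<close>, the claim is
    \<open>t * exp (-t) \<le> 1 - exp (-t) * exp (-t)\<close>. This is
    \<open>t + exp (-t) \<le> 1 + t \<le> exp t\<close> multiplied by
    \<open>exp (-t)\<close>.\<close>
  also have "\<dots> \<le> exp (-t) / t"
  proof -
    have "q = exp (-t) * exp (-t)" by (simp add: q_def flip: exp_add)
    moreover have "t * exp (-t) \<le> 1 - exp (-t) * exp (-t)"
    proof -
      have "1 + t \<le> exp t" by (rule exp_ge_add_one_self)
      moreover have "exp (-t) \<le> 1" using assms by simp
      ultimately have "t + exp (-t) \<le> exp t" by linarith
      then have "(t + exp (-t)) * exp (-t) \<le> exp t * exp (-t)"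
        by (intro mult_right_mono) auto
      then show ?thesis by (simp add: algebra_simps flip: exp_add)
    qed
    then have "exp (-t) * (t * exp (-t)) \<le> exp (-t) * (1 - exp (-t) * exp (-t))"
      by (intro mult_left_mono) auto
    ultimately show ?thesis using q assms by (simp add: field_simps)
  qed
  finally show ?thesis .
qed

text \<open>The partial sums satisfy the bound uniformly in their length, and Fatou's lemma carries
  it over to their pointwise limit.\<close>

lemma nn_integral_Phi_square_le:
  assumes t: "t > 0"
  shows "(\<integral>\<^sup>+\<omega>. ennreal ((Phi \<omega> t)\<^sup>2) \<partial>haar_Omega) \<le> ennreal (exp (-t) / t)"
proof -
  define S where "S N \<omega> = (\<Sum>n\<in>{1..N}. exp (- (real n * t)) * real_of_int (\<omega> n))" for N \<omega>
  have [measurable]: "S N \<in> borel_measurable haar_Omega" for N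
    unfolding S_def by (intro borel_measurable_sum borel_measurable_times) auto
  \<comment> \<open>Summing over \<open>{1..N}\<close> gives exactly the first \<open>N\<close>
    terms of the series shifted by \<open>Suc\<close>.\<close>
  have "(\<lambda>N. S N \<omega>) \<longlonglongrightarrow> Phi \<omega> t" if "\<omega> \<in> space haar_Omega" for \<omega>
    using Phi_sums[OF that t]
    by (simp add: sums_def S_def sum.atLeast1_atMost_eq atLeast0LessThan mult.commute)
  then have "(\<integral>\<^sup>+\<omega>. ennreal ((Phi \<omega> t)\<^sup>2) \<partial>haar_Omega)
      = (\<integral>\<^sup>+\<omega>. liminf (\<lambda>N. ennreal ((S N \<omega>)\<^sup>2)) \<partial>haar_Omega)"
    by (intro nn_integral_cong sym[OF lim_imp_Liminf] tendsto_ennrealI tendsto_power) auto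
  also have "\<dots> \<le> liminf (\<lambda>N. \<integral>\<^sup>+\<omega>. ennreal ((S N \<omega>)\<^sup>2) \<partial>haar_Omega)"
    by (intro nn_integral_liminf) auto
  also have "\<dots> \<le> liminf (\<lambda>N::nat. ennreal (exp (-t) / t))"
  proof (intro Liminf_mono always_eventually allI)
    fix N
    have "(\<integral>\<^sup>+\<omega>. ennreal ((S N \<omega>)\<^sup>2) \<partial>haar_Omega)
        = ennreal (2/3 * (\<Sum>n\<in>{1..N}. (exp (- (real n * t)))\<^sup>2))"
      unfolding S_def by (rule nn_integral_sum_coordinates_square) auto
    also have "\<dots> \<le> ennreal (exp (-t) / t)"
    proof (intro ennreal_leI)
      \<comment> \<open>Nonnegativity allows the variance factor 2/3 to be replaced by 1.\<close>
      have "0 \<le> (\<Sum>n\<in>{1..N}. (exp (- (real n * t)))\<^sup>2)"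
        by (intro sum_nonneg) auto
      then show "2/3 * (\<Sum>n\<in>{1..N}. (exp (- (real n * t)))\<^sup>2) \<le> exp (-t) / t"
        using sum_exp_le[OF t, of N] by linarith
    qed
    finally show "(\<integral>\<^sup>+\<omega>. ennreal ((S N \<omega>)\<^sup>2) \<partial>haar_Omega) \<le> ennreal (exp (-t) / t)" .
  qed
  finally show ?thesis by (simp add: Liminf_const)
qed

section \<open>Gamma integral and almost sure finiteness\<close>

lemma nn_integral_exp_div_powr_finite:
  assumes p: "0 < p" "p < 2"
  shows "(\<integral>\<^sup>+t\<in>{0<..}. ennreal ((exp (-t) / t) powr (p/2)) \<partial>lborel) < \<infinity>"
proof -
  \<comment> \<open>The integrand is \<open>t powr (- (p/2)) * exp (- (p/2 * t))\<close>, the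
    absolute value of a Gamma integrand with argument \<open>?z\<close> and rate \<open>p/2\<close>.
    Convergence at 0 needs Re \<open>?z\<close> > 0, that is p < 2; decay at infinity needs p >
    0.\<close>
  let ?z = "complex_of_real (1 - p/2)"
  let ?g = "\<lambda>t. indicat_real {0<..} t *\<^sub>R (complex_of_real t powr (?z - 1) / of_real (exp (p/2 * t)))"
  have "(\<lambda>t. complex_of_real t powr (?z - 1) / of_real (exp (p/2 * t))) absolutely_integrable_on {0<..}"
    by (rule absolutely_integrable_Gamma_integral) (use p in auto)
  then have "integrable lebesgue (\<lambda>t. norm (?g t))"
    unfolding set_integrable_def by (rule integrable_norm)
  then have "(\<integral>\<^sup>+t. ennreal (norm (norm (?g t))) \<partial>lebesgue) < \<infinity>"
    by (simp only: integrable_iff_bounded)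
  also have "(\<integral>\<^sup>+t. ennreal (norm (norm (?g t))) \<partial>lebesgue)
      = (\<integral>\<^sup>+t\<in>{0<..}. ennreal ((exp (-t) / t) powr (p/2)) \<partial>lebesgue)"
  proof (intro nn_integral_cong)
    fix t :: real
    show "ennreal (norm (norm (?g t)))
        = ennreal ((exp (-t) / t) powr (p/2)) * indicator {0<..} t"
    proof (cases "t > 0")
      case True
      then have "norm (complex_of_real t powr (?z - 1)) = t powr (- (p/2))"
        by (subst norm_powr_real_powr) auto
      moreover have "(exp (-t) / t) powr (p/2) = exp (- (p/2 * t)) / t powr (p/2)"
        using True by (simp add: powr_divide exp_powr_real mult.commute)
      then have "(exp (-t) / t) powr (p/2) = t powr (- (p/2)) / exp (p/2 * t)"
        by (simp only: exp_minus powr_minus divide_inverse mult.commute)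
      ultimately show ?thesis using True by (simp add: norm_divide)
    qed auto
  qed
  finally show ?thesis by (simp add: nn_integral_completion)
qed

lemma measure_in_Lp_Phi_eq_1:
  assumes p: "0 < p" "p < 2"
  shows "measure haar_Omega {\<omega> \<in> space haar_Omega. in_Lp p {0<..} (Phi \<omega>)} = 1"
proof -
  interpret haar: prob_space haar_Omega by (rule prob_space_haar_Omega)
  interpret P: pair_sigma_finite haar_Omega lborel ..
  define I where "I \<omega> = (\<integral>\<^sup>+t\<in>{0<..}. ennreal (\<bar>Phi \<omega> t\<bar> powr p) \<partial>lborel)" for \<omega>
  have [measurable]: "I \<in> borel_measurable haar_Omega"
    unfolding I_def by measurable
  have slice: "Phi \<omega> \<in> borel_measurable borel" for \<omega>
    unfolding Phi_def by measurable
  \<comment> \<open>Each path is Borel, so the measurability clause always holds and passing from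
    \<open>lebesgue\<close> to \<open>lborel\<close> leaves the integral unchanged. Membership thus
    becomes an event described by the measurable function \<open>I\<close>.\<close>
  have in_Lp_iff: "in_Lp p {0<..} (Phi \<omega>) \<longleftrightarrow> I \<omega> < \<infinity>" for \<omega>
  proof -
    have "set_borel_measurable lebesgue {0<..} (Phi \<omega>)"
      using slice[of \<omega>] unfolding set_borel_measurable_def
      by (intro measurable_completion) simp
    then show ?thesis
      by (simp add: in_Lp_def I_def nn_integral_completion)
  qed
  \<comment> \<open>Tonelli: by joint measurability of \<open>Phi\<close> the expectation moves
    inside, where the moment bound applies for each fixed t > 0.\<close>
  have "(\<integral>\<^sup>+\<omega>. I \<omega> \<partial>haar_Omega)
      = (\<integral>\<^sup>+t. (\<integral>\<^sup>+\<omega>. ennreal (\<bar>Phi \<omega> t\<bar> powr p) * indicator {0<..} t \<partial>haar_Omega) \<partial>lborel)"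
    unfolding I_def by (rule P.Fubini'[symmetric]) measurable
  also have "\<dots> \<le> (\<integral>\<^sup>+t. 2 * (ennreal ((exp (-t) / t) powr (p/2)) * indicator {0<..} t) \<partial>lborel)"
  proof (intro nn_integral_mono)
    fix t :: real
    show "(\<integral>\<^sup>+\<omega>. ennreal (\<bar>Phi \<omega> t\<bar> powr p) * indicator {0<..} t \<partial>haar_Omega)
        \<le> 2 * (ennreal ((exp (-t) / t) powr (p/2)) * indicator {0<..} t)"
    proof (cases "t > 0")
      case True
      have "(\<lambda>\<omega>. Phi \<omega> t) \<in> borel_measurable haar_Omega"
        by measurable
      from haar.nn_integral_powr_le[OF this _ p nn_integral_Phi_square_le[OF True]] True
      show ?thesis by simp
    qed simp
  qed
  also have "\<dots> = 2 * (\<integral>\<^sup>+t\<in>{0<..}. ennreal ((exp (-t) / t) powr (p/2)) \<partial>lborel)"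
    by (rule nn_integral_cmult) measurable
  also have "\<dots> < \<infinity>"
    using nn_integral_exp_div_powr_finite[OF p] by (simp add: ennreal_mult_less_top)
  finally have "AE \<omega> in haar_Omega. I \<omega> \<noteq> \<infinity>"
    by (intro nn_integral_PInf_AE) auto
  then have "AE \<omega> in haar_Omega. I \<omega> < \<infinity>"
    by (simp add: less_top)
  then show ?thesis
    unfolding in_Lp_iff by (subst haar.prob_Collect_eq_1) auto
qed

theorem proposition6p1:
  shows "(\<forall>p::real. 0 < p \<and> p < 2 \<longrightarrow>
            measure haar_Omega {\<omega> \<in> space haar_Omega. in_Lp p {0<..} (Phi \<omega>)} = 1) \<and>
         (\<forall>\<epsilon>::real. 0 < \<epsilon> \<and> \<epsilon> < 2 \<longrightarrow>
            measure haar_Omega {\<omega> \<in> space haar_Omega. in_Lp (2 - \<epsilon>) {0<..} (Phi \<omega>)} = 1)"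
  \<comment> \<open>The second family is the first at exponent \<open>2 - \<epsilon>\<close>, which
    again lies strictly between 0 and 2.\<close>
  by (intro conjI allI impI measure_in_Lp_Phi_eq_1) simp_all

end
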